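(* Let $p>1$, $q=p/(p-1)$ and $r=\min\{q,2\}$. Let $c_p>0$ be a constant, depending only on $p$, such that $c_p^{-1}\|\eta\|_{\psi_p}\le\tau_{\varphi_p}(\eta)\le c_p\|\eta\|_{\psi_p}$ for every centered (mean zero) random variable $\eta$ with $\|\eta\|_{\psi_p}<\infty$. Let $n\ge 1$ and assume that a random vector $\xi=(\xi_i)_{i=1}^n$ has independent, mean zero, $p$-sub-exponential coordinates. Then $$\|\xi\|_{\psi_p}\le n^{1/r-1/q}\,c_p^2\max_{1\le i\le n}\|\xi_i\|_{\psi_p}.$$
   Context: For a real random variable $\eta$ and $p\ge 1$, $\|\eta\|_{\psi_p}=\inf\{K>0:\ \mathbb{E}\exp(|\eta/K|^p)\le 2\}$ (with value $\infty$ if no such $K$ exists); $\eta$ is called $p$-sub-exponential if $\|\eta\|_{\psi_p}<\infty$. For $s>1$ define $\varphi_s:\mathbb{R}\to\mathbb{R}$ by $\varphi_s(x)=x^2/2$ if $|x|\le 1$ and $\varphi_s(x)=|x|^s/s-1/s+1/2$ if $|x|>1$. For $p>1$, $q=p/(p-1)$, and a centered random variable $\eta$, set $$\tau_{\varphi_p}(\eta)=\inf\{K>0:\ \forall t\in\mathbb{R}\ \ \mathbb{E}\exp(t\eta)\le\exp\varphi_q(Kt)\}.$$ It is known that $\tau_{\varphi_p}$ is a norm equivalent to $\|\cdot\|_{\psi_p}$ on centered random variables with finite $\psi_p$-norm, so that a constant $c_p$ as in the claim exists. For a random vector $\xi=(\xi_i)_{i=1}^n$ in $\mathbb{R}^n$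 define $\|\xi\|_{\psi_p}=\sup_{|\mathbf{t}|_q=1}\|\langle\xi,\mathbf{t}\rangle\|_{\psi_p}$, where the supremum is over deterministic $\mathbf{t}\in\mathbb{R}^n$, $|\mathbf{t}|_q=(\sum_{i=1}^n|t_i|^q)^{1/q}$, and $\langle\cdot,\cdot\rangle$ is the standard inner product. *)

theory Defs
  imports "HOL-Probability.Probability"
begin

text \<open>
  Norms take values in \<^typ>\<open>ennreal\<close>, so that the infimum of the empty set is \<open>\<infinity>\<close>.
  Exponential moments are nonnegative Lebesgue integrals, hence \<open>\<infinity>\<close> (rather than 0) when
  they diverge.
\<close>

definition psi_norm :: "'a measure \<Rightarrow> real \<Rightarrow> ('a \<Rightarrow> real) \<Rightarrow> ennreal" where
  "psi_norm M p \<eta> =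
     Inf {ennreal K |K. K > 0 \<and> (\<integral>\<^sup>+\<omega>. ennreal (exp (\<bar>\<eta> \<omega> / K\<bar> powr p)) \<partial>M) \<le> 2}"

definition sub_exponential :: "'a measure \<Rightarrow> real \<Rightarrow> ('a \<Rightarrow> real) \<Rightarrow> bool" where
  "sub_exponential M p \<eta> \<longleftrightarrow> \<eta> \<in> borel_measurable M \<and> psi_norm M p \<eta> < \<infinity>"

text \<open>Integrability is explicit because the Bochner integral of a non-integrable function is 0.\<close>

definition centered :: "'a measure \<Rightarrow> ('a \<Rightarrow> real) \<Rightarrow> bool" where
  "centered M \<eta> \<longleftrightarrow> integrable M \<eta> \<and> (\<integral>\<omega>. \<eta> \<omega> \<partial>M) = 0"

definition phi :: "real \<Rightarrow> real \<Rightarrow> real" where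
  "phi s x = (if \<bar>x\<bar> \<le> 1 then x\<^sup>2 / 2 else \<bar>x\<bar> powr s / s - 1 / s + 1 / 2)"

text \<open>The index is \<open>p\<close>, while the bound uses \<open>phi\<close> at the conjugate exponent \<open>p / (p - 1)\<close>.\<close>

definition tau_norm :: "'a measure \<Rightarrow> real \<Rightarrow> ('a \<Rightarrow> real) \<Rightarrow> ennreal" where
  "tau_norm M p \<eta> =
     Inf {ennreal K |K. K > 0 \<and>
       (\<forall>t::real. (\<integral>\<^sup>+\<omega>. ennreal (exp (t * \<eta> \<omega>)) \<partial>M)
                    \<le> ennreal (exp (phi (p / (p - 1)) (K * t))))}"

text \<open>
  HOL cannot quantify over the type of the sample space inside a formula. The constant is therefore
  required to work for random variables on all probability spaces whose sample points are reals.
  Everything involved depends only on the law of \<open>\<eta>\<close>, so this covers every probability space;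
  see \<open>psi_tau_constD\<close> below.
\<close>

definition psi_tau_const :: "real \<Rightarrow> real \<Rightarrow> bool" where
  "psi_tau_const p c \<longleftrightarrow> c > 0 \<and>
     (\<forall>(N :: real measure) \<eta>.
        prob_space N \<longrightarrow> centered N \<eta> \<longrightarrow> psi_norm N p \<eta> < \<infinity> \<longrightarrow>
        ennreal (inverse c) * psi_norm N p \<eta> \<le> tau_norm N p \<eta> \<and>
        tau_norm N p \<eta> \<le> ennreal c * psi_norm N p \<eta>)"

lemma psi_tau_constD:
  fixes M :: "'a measure" and \<eta> :: "'a \<Rightarrow> real"
  assumes c: "psi_tau_const p c" and M: "prob_space M"
    and \<eta>: "centered M \<eta>" and fin: "psi_norm M p \<eta> < \<infinity>"
  shows "ennreal (inverse c) * psi_norm M p \<eta> \<le> tau_norm M p \<eta>"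
    and "tau_norm M p \<eta> \<le> ennreal c * psi_norm M p \<eta>"
proof -
  let ?N = "distr M borel \<eta>" and ?id = "\<lambda>x::real. x"
  have meas [measurable]: "\<eta> \<in> borel_measurable M"
    using \<eta> by (auto simp: centered_def)
  have N: "prob_space ?N"
    using M meas by (rule prob_space.prob_space_distr)
  have psi: "psi_norm ?N p ?id = psi_norm M p \<eta>"
    unfolding psi_norm_def by (simp add: nn_integral_distr)
  have tau: "tau_norm ?N p ?id = tau_norm M p \<eta>"
    unfolding tau_norm_def by (simp add: nn_integral_distr)
  have "centered ?N ?id"
    using \<eta> unfolding centered_def by (simp add: integrable_distr_eq integral_distr)
  with c N fin psi tau
  show "ennreal (inverse c) * psi_norm M p \<eta> \<le> tau_norm M p \<eta>"
    and "tau_norm M p \<eta> \<le> ennreal c * psi_norm M p \<eta>"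
    unfolding psi_tau_const_def by metis+
qed

definition lq_norm :: "real \<Rightarrow> real ^ 'n \<Rightarrow> real" where
  "lq_norm q t = (\<Sum>i\<in>UNIV. \<bar>t $ i\<bar> powr q) powr (1 / q)"

definition psi_norm_vec :: "'a measure \<Rightarrow> real \<Rightarrow> ('a \<Rightarrow> real ^ 'n) \<Rightarrow> ennreal" where
  "psi_norm_vec M p \<xi> =
     (SUP t\<in>{t. lq_norm (p / (p - 1)) t = 1}. psi_norm M p (\<lambda>\<omega>. \<xi> \<omega> \<bullet> t))"

end

theory Submission
  imports Defs
begin

text \<open>
  The function \<open>phi q y / y powr r\<close> is nondecreasing in \<open>y > 0\<close>. Hence, writing \<open>T\<close> for the
  \<open>r\<close>-norm of \<open>t\<close>, each \<open>phi q (x * t\<^sub>i)\<close> is at most \<open>(\<bar>t\<^sub>i\<bar> / T) powr r * phi q (T * x)\<close>, and these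
  bounds sum to \<open>phi q (T * x)\<close>. By independence the \<open>tau\<close>-norm of \<open>\<xi> \<bullet> t\<close> is then at most \<open>T\<close>
  times the largest \<open>tau\<close>-norm of a coordinate. The power mean inequality gives
  \<open>T \<le> n powr (1 / r - 1 / q)\<close> when the \<open>q\<close>-norm of \<open>t\<close> is 1, and passing from the
  \<open>psi\<close>-norm to the \<open>tau\<close>-norm and back costs \<open>c\<close> each way.
\<close>

section \<open>Power mean inequalities for finite sums\<close>

text \<open>The right side is the tangent at 1 of the concave power; Young's inequality for
  \<open>x\<close> and 1 gives it.\<close>

lemma powr_le_affine:
  fixes x a :: real
  assumes "0 \<le> x" "0 \<le> a" "a \<le> 1"
  shows "x powr a \<le> a * x + (1 - a)"
proof (cases "x = 0")
  case False
  then show ?thesis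
    using Youngs_inequality_0[of a "1 - a" x 1] assms by simp
qed (use assms in simp)

text \<open>Rescaling by \<open>n / S\<close> gives the \<open>b i\<close> mean 1. The tangent bound
  is exact at 1, so its sum over the rescaled terms is exactly \<open>n\<close>, whatever
  \<open>a\<close> is.\<close>

lemma sum_powr_le_card:
  fixes b :: "'i \<Rightarrow> real"
  assumes I: "finite I" and b: "\<And>i. i \<in> I \<Longrightarrow> 0 \<le> b i" and a: "0 \<le> a" "a \<le> 1"
  shows "(\<Sum>i\<in>I. b i powr a) \<le> real (card I) powr (1 - a) * (\<Sum>i\<in>I. b i) powr a"
proof (cases "(\<Sum>i\<in>I. b i) = 0")
  case True
  then have "\<forall>i\<in>I. b i = 0"
    using I b by (simp add: sum_nonneg_eq_0_iff)
  then show ?thesis by simp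
next
  case False
  define S where "S = (\<Sum>i\<in>I. b i)"
  define n where "n = real (card I)"
  have S: "S > 0"
    using False b sum_nonneg[of I b] by (simp add: S_def less_le)
  have n: "n > 0"
    using False I by (auto simp: n_def card_gt_0_iff)
  have "(n / S) powr a * (\<Sum>i\<in>I. b i powr a) = (\<Sum>i\<in>I. (n / S * b i) powr a)"
    unfolding sum_distrib_left by (intro sum.cong refl powr_mult[symmetric])
  also have "\<dots> \<le> (\<Sum>i\<in>I. a * (n / S * b i) + (1 - a))"
    using S n b a by (intro sum_mono powr_le_affine) auto
  also have "\<dots> = a * (n / S * S) + n * (1 - a)"
    by (simp only: sum.distrib sum_distrib_left[symmetric] sum_constant S_def n_def)
  also have "\<dots> = n"
    using S by (simp add: algebra_simps)
  finally have "(n / S) powr a * (\<Sum>i\<in>I. b i powr a) \<le> n" .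
  then have "(\<Sum>i\<in>I. b i powr a) \<le> n / (n / S) powr a"
    using S n by (simp add: pos_le_divide_eq mult.commute)
  also have "\<dots> = n powr (1 - a) * S powr a"
    using S n by (simp add: powr_divide powr_diff)
  finally show ?thesis by (simp add: S_def n_def)
qed

text \<open>The concave case with exponent \<open>1 / p\<close>, applied to the \<open>p\<close>-th
  powers and then raised to the power \<open>p\<close>.\<close>

lemma sum_powr_le_card_power:
  fixes b :: "'i \<Rightarrow> real"
  assumes I: "finite I" and b: "\<And>i. i \<in> I \<Longrightarrow> 0 \<le> b i" and p: "1 \<le> p"
  shows "(\<Sum>i\<in>I. b i) powr p \<le> real (card I) powr (p - 1) * (\<Sum>i\<in>I. b i powr p)"
proof -
  have "(\<Sum>i\<in>I. b i) = (\<Sum>i\<in>I. (b i powr p) powr (1 / p))"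
    using b p by (intro sum.cong) (auto simp: powr_powr)
  also have "\<dots> \<le> real (card I) powr (1 - 1 / p) * (\<Sum>i\<in>I. b i powr p) powr (1 / p)"
    using I p by (intro sum_powr_le_card) auto
  finally have "(\<Sum>i\<in>I. b i) powr p
      \<le> (real (card I) powr (1 - 1 / p) * (\<Sum>i\<in>I. b i powr p) powr (1 / p)) powr p"
    using p b by (intro powr_mono2 sum_nonneg) auto
  also have "\<dots> = real (card I) powr (p - 1) * (\<Sum>i\<in>I. b i powr p)"
    using p by (simp add: powr_mult powr_powr sum_nonneg algebra_simps)
  finally show ?thesis .
qed

section \<open>Growth of \<open>phi\<close>\<close>

text \<open>As \<open>phi s 1 = 1 / 2\<close>, this compares
  \<open>phi s y / y powr (min s 2)\<close> with its value at 1. For \<open>s \<le> 2\<close> the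
  difference of the sides factors as \<open>(1 / s - 1 / 2) * (y powr s - 1)\<close>; for
  \<open>s > 2\<close> the claim is half of the tangent bound at \<open>y powr s\<close> with
  exponent \<open>2 / s\<close>.\<close>

lemma half_powr_le_phi:
  assumes s: "0 < s" and y: "1 < y"
  shows "y powr (min s 2) / 2 \<le> phi s y"
proof (cases "s \<le> 2")
  case True
  have "0 \<le> (1 / s - 1 / 2) * (y powr s - 1)"
    using s True y by (intro mult_nonneg_nonneg) (auto simp: field_simps ge_one_powr_ge_zero)
  then show ?thesis
    using True y by (simp add: phi_def algebra_simps diff_divide_distrib)
next
  case False
  have "(y powr s) powr (2 / s) \<le> 2 / s * y powr s + (1 - 2 / s)"
    using False by (intro powr_le_affine) auto
  then show ?thesis
    using False y by (simp add: phi_def powr_powr algebra_simps)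
qed

text \<open>The cases record which of \<open>l * y \<le> y\<close> lie in the quadratic range of
  \<open>phi\<close>. When 1 separates them, the value \<open>1 / 2\<close> at 1 mediates between
  the two formulas.\<close>

lemma phi_mult_le:
  assumes s: "0 < s" and l: "0 \<le> l" "l \<le> 1" and y: "0 \<le> y"
  shows "phi s (l * y) \<le> l powr (min s 2) * phi s y"
proof (cases "l = 0")
  case True
  then show ?thesis by (simp add: phi_def)
next
  case False
  with l have l0: "l > 0" by simp
  consider "y \<le> 1" | "1 < y" "l * y \<le> 1" | "1 < l * y"
    by linarith
  then show ?thesis
  proof cases
    case 1
    have "l\<^sup>2 = l powr 2" using l0 by simp
    also have "\<dots> \<le> l powr (min s 2)"
      using l0 l by (intro powr_mono') auto
    finally have "l\<^sup>2 * (y\<^sup>2 / 2) \<le> l powr (min s 2) * (y\<^sup>2 / 2)"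
      by (intro mult_right_mono) auto
    moreover have "l * y \<le> 1"
      using 1 l y by (simp add: mult_le_one)
    ultimately show ?thesis
      using 1 l y by (simp add: phi_def power_mult_distrib)
  next
    case 2
    have "phi s (l * y) = (l * y) powr 2 / 2"
      using 2 l0 by (simp add: phi_def)
    \<comment> \<open>The base is at most 1, so lowering the exponent from 2 increases the
      power.\<close>
    also have "\<dots> \<le> (l * y) powr (min s 2) / 2"
      using 2 l0 by (intro divide_right_mono powr_mono') auto
    also have "\<dots> = l powr (min s 2) * (y powr (min s 2) / 2)"
      using l y by (simp add: powr_mult)
    also have "\<dots> \<le> l powr (min s 2) * phi s y"
      using half_powr_le_phi[OF s] 2 by (intro mult_left_mono) auto
    finally show ?thesis .
  next
    case 3
    have "l * y \<le> 1 * y"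
      using l y by (intro mult_right_mono) auto
    with 3 have y1: "1 < y" by simp
    show ?thesis
    proof (cases "s \<le> 2")
      case True
      \<comment> \<open>The terms in \<open>y\<close> agree on both sides of the goal, so only the
        constants remain to be compared.\<close>
      have "l powr s * (1 / s - 1 / 2) \<le> 1 * (1 / s - 1 / 2)"
        using s True l by (intro mult_right_mono powr_le1) (auto simp: field_simps)
      then show ?thesis
        using True 3 y1 l0 by (simp add: phi_def powr_mult abs_mult algebra_simps)
    next
      case False
      \<comment> \<open>Multiplied by \<open>s\<close>, the goal reads \<open>(s - 2) / 2 * (1 -
        l\<^sup>2) \<le> y powr s * (l\<^sup>2 - l powr s)\<close>. Since \<open>y > 1 / l\<close>,
        it suffices to treat \<open>y = 1 / l\<close>, where the right side is
        \<open>l powr (2 - s) - 1\<close>. The number \<open>(2 - s) * ln l\<close> separates the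
        two sides.\<close>
      have "1 - l\<^sup>2 \<le> - ln (l\<^sup>2)"
        using ln_le_minus_one[of "l\<^sup>2"] l0 by simp
      then have "(s - 2) / 2 * (1 - l\<^sup>2) \<le> (s - 2) / 2 * (- ln (l\<^sup>2))"
        using False by (intro mult_left_mono) auto
      also have "\<dots> = (2 - s) * ln l"
        using l0 by (simp add: ln_realpow field_simps)
      also have "\<dots> \<le> l powr (2 - s) - 1"
        using exp_ge_add_one_self[of "(2 - s) * ln l"] l0 by (simp add: powr_def del: exp_ge_add_one_self)
      also have "\<dots> = l powr (- s) * (l\<^sup>2 - l powr s)"
        using l0 by (simp add: right_diff_distrib powr_diff powr_minus field_simps)
      also have "\<dots> \<le> y powr s * (l\<^sup>2 - l powr s)"
      proof (intro mult_right_mono)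
        have "1 \<le> (l * y) powr s"
          using 3 s by (intro ge_one_powr_ge_zero) auto
        then show "l powr (- s) \<le> y powr s"
          using l0 y by (simp add: powr_mult powr_minus field_simps)
        have "l powr s \<le> l powr 2"
          using False l by (intro powr_mono') auto
        then show "0 \<le> l\<^sup>2 - l powr s"
          using l0 by simp
      qed
      finally have "(s - 2) / 2 * (1 - l\<^sup>2) / s \<le> y powr s * (l\<^sup>2 - l powr s) / s"
        using s by (intro divide_right_mono) auto
      moreover have "(s - 2) / 2 * (1 - l\<^sup>2) / s = (1 / 2 - 1 / s) * (1 - l\<^sup>2)"
        using s by (simp add: field_simps)
      moreover have "phi s (l * y) = l powr s * y powr s / s - 1 / s + 1 / 2"
        using 3 l0 y by (simp add: phi_def powr_mult)
      moreover have "l powr (min s 2) * phi s y = l\<^sup>2 * (y powr s / s - 1 / s + 1 / 2)"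
        using False y1 l0 by (simp add: phi_def)
      ultimately show ?thesis
        by (simp add: algebra_simps diff_divide_distrib)
    qed
  qed
qed

lemma phi_nonneg:
  assumes "0 < s" "0 \<le> y" shows "0 \<le> phi s y"
proof (cases "y \<le> 1")
  case False
  then show ?thesis
    using half_powr_le_phi[of s y] assms powr_ge_zero[of y "min s 2"] by linarith
qed (use assms in \<open>simp add: phi_def\<close>)

lemma phi_abs: "phi s \<bar>x\<bar> = phi s x"
  by (simp add: phi_def)

text \<open>Scaling by \<open>\<bar>x\<bar> / \<bar>y\<bar> \<le> 1\<close> in
  \<open>phi_mult_le\<close> produces a factor of at most 1.\<close>

lemma phi_mono:
  assumes s: "0 < s" and xy: "\<bar>x\<bar> \<le> \<bar>y\<bar>"
  shows "phi s x \<le> phi s y"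
proof (cases "y = 0")
  case False
  have ratio: "\<bar>x\<bar> / \<bar>y\<bar> \<le> 1"
    using xy False by (simp add: divide_le_eq)
  have "phi s (\<bar>x\<bar> / \<bar>y\<bar> * \<bar>y\<bar>) \<le> (\<bar>x\<bar> / \<bar>y\<bar>) powr (min s 2) * phi s \<bar>y\<bar>"
    using s ratio by (intro phi_mult_le) auto
  also have "\<dots> \<le> 1 * phi s \<bar>y\<bar>"
    using s ratio by (intro mult_right_mono powr_le1 phi_nonneg) auto
  finally show ?thesis
    using False by (simp add: phi_abs)
qed (use xy in simp)

lemma sum_phi_le:
  fixes t :: "'i \<Rightarrow> real"
  assumes s: "0 < s" and I: "finite I" and r: "r = min s 2"
    and T: "T = (\<Sum>i\<in>I. \<bar>t i\<bar> powr r) powr (1 / r)" "T > 0"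
  shows "(\<Sum>i\<in>I. phi s (x * t i)) \<le> phi s (T * x)"
proof -
  have r0: "r > 0" using s r by simp
  have S: "(\<Sum>i\<in>I. \<bar>t i\<bar> powr r) = T powr r"
    using T r0 by (simp add: powr_powr sum_nonneg)
  have "phi s (x * t i) \<le> (\<bar>t i\<bar> / T) powr r * phi s (T * x)" if "i \<in> I" for i
  proof -
    \<comment> \<open>One term is at most the whole sum, so \<open>\<bar>t i\<bar> / T\<close> is an
      admissible factor \<open>l\<close> in \<open>phi_mult_le\<close>.\<close>
    have "\<bar>t i\<bar> powr r \<le> T powr r"
      unfolding S[symmetric] using I that by (intro member_le_sum) auto
    then have "\<bar>t i\<bar> \<le> T"
      using r0 T(2) powr_less_mono2[of r T "\<bar>t i\<bar>"] by linarith
    then have "phi s (\<bar>t i\<bar> / T * (T * \<bar>x\<bar>)) \<le> (\<bar>t i\<bar> / T) powr r * phi s (T * \<bar>x\<bar>)"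
      unfolding r using s T(2) by (intro phi_mult_le) auto
    then show ?thesis
      using T(2) phi_abs[of s "x * t i"] phi_abs[of s "T * x"]
      by (simp add: abs_mult mult.commute)
  qed
  then have "(\<Sum>i\<in>I. phi s (x * t i)) \<le> (\<Sum>i\<in>I. (\<bar>t i\<bar> / T) powr r * phi s (T * x))"
    by (intro sum_mono)
  also have "\<dots> = (\<Sum>i\<in>I. \<bar>t i\<bar> powr r) / T powr r * phi s (T * x)"
    using T(2) by (simp add: powr_divide sum_divide_distrib sum_distrib_right)
  also have "\<dots> = phi s (T * x)"
    unfolding S using T(2) by simp
  finally show ?thesis .
qed

section \<open>Finiteness of the \<open>psi\<close>-norm under linear combinations\<close>

lemma psi_norm_finiteD:
  assumes "psi_norm M p \<eta> < \<infinity>"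
  obtains K where "K > 0" "(\<integral>\<^sup>+\<omega>. ennreal (exp (\<bar>\<eta> \<omega> / K\<bar> powr p)) \<partial>M) \<le> 2"
  using assms unfolding psi_norm_def Inf_less_iff by auto

lemma psi_norm_le:
  assumes "K > 0" "(\<integral>\<^sup>+\<omega>. ennreal (exp (\<bar>\<eta> \<omega> / K\<bar> powr p)) \<partial>M) \<le> 2"
  shows "psi_norm M p \<eta> \<le> ennreal K"
  unfolding psi_norm_def using assms by (intro Inf_lower) auto

lemma psi_norm_scale_finite:
  assumes p: "0 \<le> p" and fin: "psi_norm M p \<eta> < \<infinity>"
  shows "psi_norm M p (\<lambda>\<omega>. a * \<eta> \<omega>) < \<infinity>"
proof -
  obtain K where K: "K > 0" "(\<integral>\<^sup>+\<omega>. ennreal (exp (\<bar>\<eta> \<omega> / K\<bar> powr p)) \<partial>M) \<le> 2"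
    using psi_norm_finiteD[OF fin] by blast
  \<comment> \<open>The summand 1 keeps the scale positive when \<open>a = 0\<close>.\<close>
  have "\<bar>a * x / ((\<bar>a\<bar> + 1) * K)\<bar> \<le> \<bar>x / K\<bar>" for x
  proof -
    have "\<bar>a * x / ((\<bar>a\<bar> + 1) * K)\<bar> = \<bar>a\<bar> / (\<bar>a\<bar> + 1) * \<bar>x / K\<bar>"
      by (simp add: abs_mult)
    also have "\<dots> \<le> 1 * \<bar>x / K\<bar>"
      by (intro mult_right_mono) auto
    finally show ?thesis by simp
  qed
  then have "(\<integral>\<^sup>+\<omega>. ennreal (exp (\<bar>a * \<eta> \<omega> / ((\<bar>a\<bar> + 1) * K)\<bar> powr p)) \<partial>M)
      \<le> (\<integral>\<^sup>+\<omega>. ennreal (exp (\<bar>\<eta> \<omega> / K\<bar> powr p)) \<partial>M)"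
    using p by (intro nn_integral_mono ennreal_leI) (simp add: powr_mono2)
  with K have "psi_norm M p (\<lambda>\<omega>. a * \<eta> \<omega>) \<le> ennreal ((\<bar>a\<bar> + 1) * K)"
    by (intro psi_norm_le) auto
  then show ?thesis
    by (simp add: order_le_less_trans)
qed

text \<open>The comparison with the \<open>tau\<close>-norm requires a finite
  \<open>psi\<close>-norm, so finiteness must be known for the sum beforehand. A crude scale
  suffices: with \<open>n * B\<close> the sum becomes a mean, and convexity bounds its exponential
  moment by the mean of the individual ones.\<close>

lemma psi_norm_sum_finite:
  fixes X :: "'i \<Rightarrow> 'a \<Rightarrow> real"
  assumes p: "1 \<le> p" and I: "finite I" "I \<noteq> {}"
    and [measurable]: "\<And>i. i \<in> I \<Longrightarrow> X i \<in> borel_measurable M"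
    and fin: "\<And>i. i \<in> I \<Longrightarrow> psi_norm M p (X i) < \<infinity>"
  shows "psi_norm M p (\<lambda>\<omega>. \<Sum>i\<in>I. X i \<omega>) < \<infinity>"
proof -
  have "\<forall>i\<in>I. \<exists>K>0. (\<integral>\<^sup>+\<omega>. ennreal (exp (\<bar>X i \<omega> / K\<bar> powr p)) \<partial>M) \<le> 2"
    using fin psi_norm_finiteD by metis
  then obtain K where K: "\<And>i. i \<in> I \<Longrightarrow> K i > 0"
    "\<And>i. i \<in> I \<Longrightarrow> (\<integral>\<^sup>+\<omega>. ennreal (exp (\<bar>X i \<omega> / K i\<bar> powr p)) \<partial>M) \<le> 2"
    by metis
  \<comment> \<open>A common scale for all summands; enlarging a scale only lowers the
    moment.\<close>
  define B where "B = Max (K ` I)"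
  define n where "n = real (card I)"
  have KB: "K i \<le> B" if "i \<in> I" for i
    unfolding B_def using that I by auto
  have B: "B > 0"
    using I K(1) KB by fastforce
  have n: "n > 0"
    using I by (simp add: n_def card_gt_0_iff)
  have moment: "(\<integral>\<^sup>+\<omega>. ennreal (exp (\<bar>X i \<omega> / B\<bar> powr p)) \<partial>M) \<le> 2" if i: "i \<in> I" for i
  proof -
    have "(\<integral>\<^sup>+\<omega>. ennreal (exp (\<bar>X i \<omega> / B\<bar> powr p)) \<partial>M)
        \<le> (\<integral>\<^sup>+\<omega>. ennreal (exp (\<bar>X i \<omega> / K i\<bar> powr p)) \<partial>M)"
      using p B K(1)[OF i] KB[OF i]
      by (intro nn_integral_mono ennreal_leI) (auto intro!: powr_mono2 divide_left_mono)
    with K(2)[OF i] show ?thesis by simp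
  qed
  have "exp (\<bar>(\<Sum>i\<in>I. X i \<omega>) / (n * B)\<bar> powr p) \<le> (\<Sum>i\<in>I. 1 / n * exp (\<bar>X i \<omega> / B\<bar> powr p))"
    (is "exp ?l \<le> _") for \<omega>
  proof -
    have "\<bar>(\<Sum>i\<in>I. X i \<omega>) / (n * B)\<bar> \<le> (\<Sum>i\<in>I. \<bar>X i \<omega> / B\<bar>) / n"
      using B n sum_abs[of "\<lambda>i. X i \<omega>" I]
      by (simp add: abs_mult sum_divide_distrib[symmetric] field_simps)
    then have "?l \<le> ((\<Sum>i\<in>I. \<bar>X i \<omega> / B\<bar>) / n) powr p"
      using p by (intro powr_mono2) auto
    also have "\<dots> = (\<Sum>i\<in>I. \<bar>X i \<omega> / B\<bar>) powr p / n powr p"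
      using n by (simp add: powr_divide sum_nonneg)
    also have "\<dots> \<le> n powr (p - 1) * (\<Sum>i\<in>I. \<bar>X i \<omega> / B\<bar> powr p) / n powr p"
      unfolding n_def using I p by (intro divide_right_mono sum_powr_le_card_power) auto
    \<comment> \<open>The powers of \<open>n\<close> combine to \<open>1 / n\<close>, which leaves a
      convex combination, written with scalar multiplication to fit Jensen's inequality for
      \<open>exp\<close>.\<close>
    also have "\<dots> = (\<Sum>i\<in>I. (1 / n) *\<^sub>R (\<bar>X i \<omega> / B\<bar> powr p))"
      using n by (simp add: powr_diff sum_divide_distrib[symmetric])
    finally have "exp ?l \<le> exp (\<Sum>i\<in>I. (1 / n) *\<^sub>R (\<bar>X i \<omega> / B\<bar> powr p))" by simp
    also have "\<dots> \<le> (\<Sum>i\<in>I. 1 / n * exp (\<bar>X i \<omega> / B\<bar> powr p))"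
      using I n by (intro convex_on_sum[OF _ _ exp_convex]) (auto simp: n_def)
    finally show ?thesis .
  qed
  then have "ennreal (exp (\<bar>(\<Sum>i\<in>I. X i \<omega>) / (n * B)\<bar> powr p))
      \<le> (\<Sum>i\<in>I. ennreal (1 / n) * ennreal (exp (\<bar>X i \<omega> / B\<bar> powr p)))" for \<omega>
    using n by (simp only: ennreal_mult[symmetric] sum_ennreal ennreal_leI divide_nonneg_pos
        mult_nonneg_nonneg zero_le_one exp_ge_zero)
  then have "(\<integral>\<^sup>+\<omega>. ennreal (exp (\<bar>(\<Sum>i\<in>I. X i \<omega>) / (n * B)\<bar> powr p)) \<partial>M)
      \<le> (\<integral>\<^sup>+\<omega>. (\<Sum>i\<in>I. ennreal (1 / n) * ennreal (exp (\<bar>X i \<omega> / B\<bar> powr p))) \<partial>M)"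
    by (intro nn_integral_mono)
  also have "\<dots> = (\<Sum>i\<in>I. ennreal (1 / n) * (\<integral>\<^sup>+\<omega>. ennreal (exp (\<bar>X i \<omega> / B\<bar> powr p)) \<partial>M))"
    by (simp add: nn_integral_sum nn_integral_cmult)
  also have "\<dots> \<le> (\<Sum>i\<in>I. ennreal (1 / n) * 2)"
    using moment by (intro sum_mono mult_left_mono) auto
  also have "\<dots> = ennreal n * ennreal (1 / n) * 2"
    by (simp add: n_def ennreal_of_nat_eq_real_of_nat mult.assoc)
  also have "\<dots> = 2"
    using n by (simp add: ennreal_mult[symmetric])
  finally have "psi_norm M p (\<lambda>\<omega>. \<Sum>i\<in>I. X i \<omega>) \<le> ennreal (n * B)"
    using n B by (intro psi_norm_le) auto
  then show ?thesis
    by (simp add: order_le_less_trans)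
qed

section \<open>The \<open>tau\<close>-norm of weighted sums of independent variables\<close>

text \<open>The strict inequality yields an admissible \<open>L < K\<close> without any claim that
  the infimum is attained; monotonicity of \<open>phi\<close> carries the bound from
  \<open>L\<close> to \<open>K\<close>.\<close>

lemma nn_integral_exp_le_of_tau_norm_less:
  assumes q: "p / (p - 1) > 0" and less: "tau_norm M p \<eta> < ennreal K"
  shows "(\<integral>\<^sup>+\<omega>. ennreal (exp (t * \<eta> \<omega>)) \<partial>M) \<le> ennreal (exp (phi (p / (p - 1)) (K * t)))"
proof -
  obtain L where L: "0 < L" "ennreal L < ennreal K"
    "(\<integral>\<^sup>+\<omega>. ennreal (exp (t * \<eta> \<omega>)) \<partial>M) \<le> ennreal (exp (phi (p / (p - 1)) (L * t)))"
    using less unfolding tau_norm_def Inf_less_iff by auto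
  have "L < K"
    using L(1,2) by (simp add: ennreal_less_iff)
  then have "phi (p / (p - 1)) (L * t) \<le> phi (p / (p - 1)) (K * t)"
    using q L(1) by (intro phi_mono) (auto simp: abs_mult intro!: mult_right_mono)
  with L(3) show ?thesis
    by (meson ennreal_leI exp_le_cancel_iff order_trans)
qed

lemma (in prob_space) tau_norm_sum_le:
  fixes X :: "'i \<Rightarrow> 'a \<Rightarrow> real"
  assumes p: "p > 1" and I: "finite I" and indep: "indep_vars (\<lambda>_. borel) X I"
    and K: "K \<ge> 0" "\<And>i. i \<in> I \<Longrightarrow> tau_norm M p (X i) \<le> ennreal K"
    and r: "r = min (p / (p - 1)) 2"
    and T: "T = (\<Sum>i\<in>I. \<bar>t i\<bar> powr r) powr (1 / r)" "T > 0"
  shows "tau_norm M p (\<lambda>\<omega>. \<Sum>i\<in>I. t i * X i \<omega>) \<le> ennreal (T * K)"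
proof (rule ennreal_le_epsilon)
  fix e :: real assume e: "0 < e"
  \<comment> \<open>The moment bound needs a constant strictly above the \<open>tau\<close>-norms.
    The excess \<open>e / T\<close> becomes exactly \<open>e\<close> after multiplication by
    \<open>T\<close>.\<close>
  define L where "L = K + e / T"
  have L: "K < L" "0 < L" and TL: "T * L = T * K + e"
    using e K(1) T(2) by (auto simp: L_def add_nonneg_pos distrib_left)
  let ?q = "p / (p - 1)"
  have q: "?q > 0" using p by simp
  have "(\<integral>\<^sup>+\<omega>. ennreal (exp (s * (\<Sum>i\<in>I. t i * X i \<omega>))) \<partial>M) \<le> ennreal (exp (phi ?q (T * L * s)))"
    for s
  proof -
    have ind: "indep_vars (\<lambda>_. borel) (\<lambda>i \<omega>. ennreal (exp (s * t i * X i \<omega>))) I"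
      by (rule indep_vars_compose2[OF indep]) measurable
    have "(\<integral>\<^sup>+\<omega>. ennreal (exp (s * (\<Sum>i\<in>I. t i * X i \<omega>))) \<partial>M)
        = (\<integral>\<^sup>+\<omega>. (\<Prod>i\<in>I. ennreal (exp (s * t i * X i \<omega>))) \<partial>M)"
      using I by (simp add: sum_distrib_left exp_sum prod_ennreal mult.assoc)
    \<comment> \<open>Independence enters here. With nonnegative integrals the product rule raises
      no question of integrability.\<close>
    also have "\<dots> = (\<Prod>i\<in>I. \<integral>\<^sup>+\<omega>. ennreal (exp (s * t i * X i \<omega>)) \<partial>M)"
      using I ind by (intro indep_vars_nn_integral) auto
    also have "\<dots> \<le> (\<Prod>i\<in>I. ennreal (exp (phi ?q (L * (s * t i)))))"
    proof (intro prod_mono_ennreal nn_integral_exp_le_of_tau_norm_less q)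
      fix i assume "i \<in> I"
      then have "tau_norm M p (X i) \<le> ennreal K" by (rule K(2))
      also have "\<dots> < ennreal L" using L K(1) by (simp add: ennreal_less_iff)
      finally show "tau_norm M p (X i) < ennreal L" .
    qed
    also have "\<dots> = ennreal (exp (\<Sum>i\<in>I. phi ?q (L * s * t i)))"
      using I by (simp add: prod_ennreal exp_sum mult.assoc)
    also have "\<dots> \<le> ennreal (exp (phi ?q (T * (L * s))))"
      using sum_phi_le[OF q I r T, of "L * s"] by (simp add: ennreal_leI)
    finally show ?thesis by (simp add: mult.assoc)
  qed
  then have "tau_norm M p (\<lambda>\<omega>. \<Sum>i\<in>I. t i * X i \<omega>) \<le> ennreal (T * L)"
    unfolding tau_norm_def using T(2) L by (intro Inf_lower) auto
  also have "\<dots> = ennreal (T * K) + ennreal e"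
    unfolding TL using K(1) T(2) e by (intro ennreal_plus) auto
  finally show "tau_norm M p (\<lambda>\<omega>. \<Sum>i\<in>I. t i * X i \<omega>) \<le> ennreal (T * K) + ennreal e" .
qed

section \<open>Comparison of the two norms along a fixed direction \<open>t\<close>\<close>

theorem proposition2p2:
  fixes M :: "'a measure" and \<xi> :: "'a \<Rightarrow> real ^ 'n" and p q r c :: real
  assumes "p > 1" and "q = p / (p - 1)" and "r = min q 2"
    and "psi_tau_const p c"
    and "prob_space M"
    and "prob_space.indep_vars M (\<lambda>_. borel) (\<lambda>i \<omega>. \<xi> \<omega> $ i) UNIV"
    and "\<And>i. centered M (\<lambda>\<omega>. \<xi> \<omega> $ i)"
    and "\<And>i. sub_exponential M p (\<lambda>\<omega>. \<xi> \<omega> $ i)"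
  shows "psi_norm_vec M p \<xi>
           \<le> ennreal (real CARD('n) powr (1 / r - 1 / q) * c\<^sup>2)
             * (MAX i. psi_norm M p (\<lambda>\<omega>. \<xi> \<omega> $ i))"
  unfolding psi_norm_vec_def
proof (rule SUP_least)
  fix t :: "real ^ 'n"
  assume "t \<in> {t. lq_norm (p / (p - 1)) t = 1}"
  then have t: "(\<Sum>i\<in>UNIV. \<bar>t $ i\<bar> powr q) powr (1 / q) = 1"
    using assms(2) by (simp add: lq_norm_def)
  interpret prob_space M by fact
  have q: "q > 1" using assms(1,2) by simp
  have r: "r > 0" "r \<le> q" using q assms(3) by auto
  have c: "c > 0" using assms(4) by (simp add: psi_tau_const_def)
  have [measurable]: "(\<lambda>\<omega>. \<xi> \<omega> $ i) \<in> borel_measurable M"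
    and fin: "psi_norm M p (\<lambda>\<omega>. \<xi> \<omega> $ i) < \<infinity>" for i
    using assms(8)[of i] by (auto simp: sub_exponential_def)
  have int [simp]: "integrable M (\<lambda>\<omega>. \<xi> \<omega> $ i)"
    and mean [simp]: "(\<integral>\<omega>. \<xi> \<omega> $ i \<partial>M) = 0" for i
    using assms(7)[of i] by (auto simp: centered_def)
  have inner: "\<xi> \<omega> \<bullet> t = (\<Sum>i\<in>UNIV. t $ i * \<xi> \<omega> $ i)" for \<omega>
    by (simp add: inner_vec_def mult.commute)
  define m where "m = (MAX i. psi_norm M p (\<lambda>\<omega>. \<xi> \<omega> $ i))"
  have m_fin: "m < \<infinity>"
    unfolding m_def using fin by (subst Max_less_iff) auto
  have le_m: "psi_norm M p (\<lambda>\<omega>. \<xi> \<omega> $ i) \<le> m" for i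
    unfolding m_def by (intro Max_ge) auto
  \<comment> \<open>A real representative of the maximum lets the constants be combined by real
    arithmetic.\<close>
  obtain K where K: "K \<ge> 0" "m = ennreal K"
    using m_fin by (cases m) auto
  have sum_q: "(\<Sum>i\<in>UNIV. \<bar>t $ i\<bar> powr q) = 1"
  proof -
    have "(\<Sum>i\<in>UNIV. \<bar>t $ i\<bar> powr q) = ((\<Sum>i\<in>UNIV. \<bar>t $ i\<bar> powr q) powr (1 / q)) powr q"
      using q by (simp add: powr_powr sum_nonneg)
    with t show ?thesis by simp
  qed
  define T where "T = (\<Sum>i\<in>UNIV. \<bar>t $ i\<bar> powr r) powr (1 / r)"
  have "\<exists>i. t $ i \<noteq> 0"
    using sum_q by (rule contrapos_pp) simp
  then obtain i where "t $ i \<noteq> 0" ..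
  then have "(\<Sum>i\<in>UNIV. \<bar>t $ i\<bar> powr r) > 0"
    by (intro sum_pos2[of _ i]) auto
  then have T0: "T > 0" by (simp add: T_def)
  \<comment> \<open>The concave power mean bound has exponent \<open>r / q \<le> 1\<close> and is
    applied to numbers of sum 1, so only the power of the dimension survives.\<close>
  have "(\<Sum>i\<in>UNIV. \<bar>t $ i\<bar> powr r) = (\<Sum>i\<in>UNIV. (\<bar>t $ i\<bar> powr q) powr (r / q))"
    using q by (simp add: powr_powr)
  also have "\<dots> \<le> real CARD('n) powr (1 - r / q) * (\<Sum>i\<in>UNIV. \<bar>t $ i\<bar> powr q) powr (r / q)"
    using q r by (intro sum_powr_le_card) auto
  also have "\<dots> = real CARD('n) powr (1 - r / q)"
    by (simp add: sum_q)
  finally have "T \<le> (real CARD('n) powr (1 - r / q)) powr (1 / r)"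
    unfolding T_def using r by (intro powr_mono2 sum_nonneg) auto
  also have "\<dots> = real CARD('n) powr (1 / r - 1 / q)"
    using r q by (simp add: powr_powr diff_divide_distrib)
  finally have T_le: "T \<le> real CARD('n) powr (1 / r - 1 / q)" .
  \<comment> \<open>The first factor \<open>c\<close>, paid for each coordinate separately.\<close>
  have "tau_norm M p (\<lambda>\<omega>. \<xi> \<omega> $ i) \<le> ennreal (c * K)" for i
  proof -
    have "tau_norm M p (\<lambda>\<omega>. \<xi> \<omega> $ i) \<le> ennreal c * psi_norm M p (\<lambda>\<omega>. \<xi> \<omega> $ i)"
      by (rule psi_tau_constD(2)[OF assms(4,5,7) fin])
    also have "\<dots> \<le> ennreal c * m"
      by (intro mult_left_mono le_m) auto
    finally show ?thesis
      using c K by (simp add: ennreal_mult)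
  qed
  then have tau: "tau_norm M p (\<lambda>\<omega>. \<xi> \<omega> \<bullet> t) \<le> ennreal (T * (c * K))"
    unfolding inner using assms(1,2,3,6) c K(1) T0
    by (intro tau_norm_sum_le[where r = r]) (auto simp: T_def)
  have cent: "centered M (\<lambda>\<omega>. \<xi> \<omega> \<bullet> t)"
    unfolding centered_def inner by simp
  have "psi_norm M p (\<lambda>\<omega>. \<xi> \<omega> \<bullet> t) < \<infinity>"
    unfolding inner using assms(1) fin by (intro psi_norm_sum_finite psi_norm_scale_finite) auto
  from psi_tau_constD(1)[OF assms(4,5) cent this] tau
  have "ennreal (inverse c) * psi_norm M p (\<lambda>\<omega>. \<xi> \<omega> \<bullet> t) \<le> ennreal (T * (c * K))"
    by (rule order_trans)
  \<comment> \<open>The second factor \<open>c\<close> arises from clearing \<open>inverse c\<close>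
    in the lower comparison for \<open>\<xi> \<omega> \<bullet> t\<close>.\<close>
  then have "ennreal c * (ennreal (inverse c) * psi_norm M p (\<lambda>\<omega>. \<xi> \<omega> \<bullet> t))
      \<le> ennreal c * ennreal (T * (c * K))"
    by (intro mult_left_mono) auto
  moreover have "ennreal c * ennreal (inverse c) = 1"
    using c by (simp add: ennreal_mult[symmetric])
  ultimately have "psi_norm M p (\<lambda>\<omega>. \<xi> \<omega> \<bullet> t) \<le> ennreal c * ennreal (T * (c * K))"
    by (simp add: mult.assoc[symmetric])
  also have "\<dots> = ennreal (T * c\<^sup>2 * K)"
    using c K(1) T0 by (simp add: ennreal_mult[symmetric] power2_eq_square mult_ac)
  also have "\<dots> \<le> ennreal (real CARD('n) powr (1 / r - 1 / q) * c\<^sup>2 * K)"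
    using T_le K(1) by (intro ennreal_leI mult_right_mono) auto
  also have "\<dots> = ennreal (real CARD('n) powr (1 / r - 1 / q) * c\<^sup>2) * m"
    unfolding K(2) using K(1) by (intro ennreal_mult) auto
  finally show "psi_norm M p (\<lambda>\<omega>. \<xi> \<omega> \<bullet> t)
      \<le> ennreal (real CARD('n) powr (1 / r - 1 / q) * c\<^sup>2)
         * (MAX i. psi_norm M p (\<lambda>\<omega>. \<xi> \<omega> $ i))"
    by (simp add: m_def)
qed

end
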